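(* Let $Y=\{Y(x),x\ge 0\}$ be a stochastic process with values in $\mathbb{R}^d$ and let $E=\{E_t,t\ge 0\}$ be a real-valued process with $E_0=0$ and nondecreasing continuous sample functions, both defined on the same probability space $(\Omega,\mathcal F,\mathbb P)$ and not necessarily independent. Let $X(t)=Y(E_t)$ for $t\ge 0$. Suppose that $E_1>0$ a.s. and that there exist constants $c_1$ and $c_2$ such that for all constants $0<a<\infty$ $$\dim_{\rm H} Y([0,a])=c_1\quad\text{and}\quad \dim_{\rm P}Y([0,a])=c_2\qquad\text{a.s.}$$ Then almost surely $$\dim_{\rm H}X([0,1])=c_1\quad\text{and}\quad \dim_{\rm P}X([0,1])=c_2 .$$
   Context: $\dim_{\rm H}$ and $\dim_{\rm P}$ denote Hausdorff dimension and packing dimension of subsets of Euclidean space. For a process $U$ and a set $I\subseteq[0,\infty)$, $U(I)=\{U(t):t\in I\}$ is the (random) range. *)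

theory Defs
  imports "HOL-Probability.Probability"
begin

(* The library's diameter is only meaningful for bounded sets, hence the boundedness requirement.
   Since 0 powr 0 = 0, the gauges below are the usual ones for s > 0 only; the dimensions
   accordingly range over s > 0, as is customary. *)

definition hausdorff_content :: "real \<Rightarrow> real \<Rightarrow> 'a::metric_space set \<Rightarrow> ennreal" where
  "hausdorff_content \<delta> s A =
     Inf {(\<Sum>i. ennreal (diameter (U i) powr s)) | U :: nat \<Rightarrow> 'a set.
            A \<subseteq> (\<Union>i. U i) \<and> (\<forall>i. bounded (U i) \<and> diameter (U i) \<le> \<delta>)}"

definition hausdorff_measure :: "real \<Rightarrow> 'a::metric_space set \<Rightarrow> ennreal" where
  "hausdorff_measure s A = (SUP \<delta>\<in>{0<..}. hausdorff_content \<delta> s A)"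

definition hausdorff_dim :: "'a::metric_space set \<Rightarrow> ennreal" where
  "hausdorff_dim A = Inf {ennreal s | s. s > 0 \<and> hausdorff_measure s A = 0}"

(* Packings by disjoint closed balls centred in A; the index set I makes them finite or countable. *)

definition packing_content :: "real \<Rightarrow> real \<Rightarrow> 'a::metric_space set \<Rightarrow> ennreal" where
  "packing_content \<delta> s A =
     Sup {(\<Sum>\<^sub>\<infinity>i\<in>I. ennreal ((2 * r i) powr s)) | (I :: nat set) (x :: nat \<Rightarrow> 'a) (r :: nat \<Rightarrow> real).
            (\<forall>i\<in>I. x i \<in> A \<and> 0 < r i \<and> r i \<le> \<delta>) \<and>
            disjoint_family_on (\<lambda>i. cball (x i) (r i)) I}"

definition packing_premeasure :: "real \<Rightarrow> 'a::metric_space set \<Rightarrow> ennreal" where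
  "packing_premeasure s A = (INF \<delta>\<in>{0<..}. packing_content \<delta> s A)"

(* The premeasure is not countably subadditive; the packing measure is the outer measure
   it induces. *)

definition packing_measure :: "real \<Rightarrow> 'a::metric_space set \<Rightarrow> ennreal" where
  "packing_measure s A =
     Inf {(\<Sum>n. packing_premeasure s (B n)) | B :: nat \<Rightarrow> 'a set. A \<subseteq> (\<Union>n. B n)}"

definition packing_dim :: "'a::metric_space set \<Rightarrow> ennreal" where
  "packing_dim A = Inf {ennreal s | s. s > 0 \<and> packing_measure s A = 0}"

end

theory Submission imports Defs begin

text \<open>Continuity of the time change gives \<open>X([0,1]) = Y([0,E\<^sub>1])\<close>. Since \<open>E\<^sub>1 > 0\<close>, this set lies
  between \<open>Y([0,1/n])\<close> and \<open>Y([0,n])\<close> for some (random) \<open>n\<close>. Almost surely the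
  hypothesis holds for these countably many deterministic times at once, so monotonicity of the
  dimensions concludes, and the dependence between \<open>Y\<close> and \<open>E\<close> plays no role.\<close>

lemma hausdorff_content_mono:
  "A \<subseteq> B \<Longrightarrow> hausdorff_content \<delta> s A \<le> hausdorff_content \<delta> s B"
  unfolding hausdorff_content_def by (rule Inf_superset_mono) blast

lemma hausdorff_measure_mono:
  "A \<subseteq> B \<Longrightarrow> hausdorff_measure s A \<le> hausdorff_measure s B"
  unfolding hausdorff_measure_def by (intro SUP_mono' hausdorff_content_mono)

text \<open>An exponent with measure zero for \<open>B\<close> also has measure zero for
  \<open>A\<close>, so the infimum for \<open>A\<close> runs over at least as many
  exponents.\<close>

lemma hausdorff_dim_mono:
  assumes "A \<subseteq> B"
  shows "hausdorff_dim A \<le> hausdorff_dim B"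
proof -
  have "hausdorff_measure s A = 0" if "hausdorff_measure s B = 0" for s
    using hausdorff_measure_mono[OF assms, of s] that by simp
  then show ?thesis
    unfolding hausdorff_dim_def by (intro Inf_superset_mono) blast
qed

text \<open>Every countable cover of \<open>B\<close> also covers \<open>A\<close>, so the infimum
  for \<open>A\<close> runs over a larger family.\<close>

lemma packing_measure_mono:
  "A \<subseteq> B \<Longrightarrow> packing_measure s A \<le> packing_measure s B"
  unfolding packing_measure_def by (rule Inf_superset_mono) blast

lemma packing_dim_mono:
  assumes "A \<subseteq> B"
  shows "packing_dim A \<le> packing_dim B"
proof -
  have "packing_measure s A = 0" if "packing_measure s B = 0" for s
    using packing_measure_mono[OF assms, of s] that by simp
  then show ?thesis
    unfolding packing_dim_def by (intro Inf_superset_mono) blast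
qed

text \<open>Monotonicity confines the values to the target interval; the intermediate value theorem
  shows that none is skipped. Flat stretches of \<open>f\<close> are harmless.\<close>

lemma image_Icc_mono_on_continuous:
  fixes f :: "real \<Rightarrow> real"
  assumes "a \<le> b" "mono_on {a..b} f" "continuous_on {a..b} f"
  shows "f ` {a..b} = {f a..f b}"
proof
  show "f ` {a..b} \<subseteq> {f a..f b}"
    using assms(1,2) by (auto simp: mono_on_def)
  show "{f a..f b} \<subseteq> f ` {a..b}"
  proof
    fix y assume "y \<in> {f a..f b}"
    then show "y \<in> f ` {a..b}"
      using IVT'[of f a y b] assms(1,3) by fastforce
  qed
qed

theorem theorem2p1:
  fixes M :: "'w measure"
    and Y :: "real \<Rightarrow> 'w \<Rightarrow> real ^ 'd"
    and E :: "real \<Rightarrow> 'w \<Rightarrow> real"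
    and X :: "real \<Rightarrow> 'w \<Rightarrow> real ^ 'd"
    and c1 c2 :: ennreal
  assumes "prob_space M"
    and "\<And>x. x \<ge> 0 \<Longrightarrow> Y x \<in> borel_measurable M"
    and "\<And>t. t \<ge> 0 \<Longrightarrow> E t \<in> borel_measurable M"
    and "\<And>\<omega>. \<omega> \<in> space M \<Longrightarrow> E 0 \<omega> = 0"
    and "\<And>\<omega>. \<omega> \<in> space M \<Longrightarrow> mono_on {0..} (\<lambda>t. E t \<omega>)"
    and "\<And>\<omega>. \<omega> \<in> space M \<Longrightarrow> continuous_on {0..} (\<lambda>t. E t \<omega>)"
    and "\<And>t \<omega>. t \<ge> 0 \<Longrightarrow> \<omega> \<in> space M \<Longrightarrow> X t \<omega> = Y (E t \<omega>) \<omega>"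
    and "AE \<omega> in M. E 1 \<omega> > 0"
    and "\<And>a. 0 < a \<Longrightarrow>
           AE \<omega> in M. hausdorff_dim ((\<lambda>x. Y x \<omega>) ` {0..a}) = c1 \<and>
                      packing_dim ((\<lambda>x. Y x \<omega>) ` {0..a}) = c2"
  shows "AE \<omega> in M. hausdorff_dim ((\<lambda>t. X t \<omega>) ` {0..1}) = c1 \<and>
                    packing_dim ((\<lambda>t. X t \<omega>) ` {0..1}) = c2"
proof -
  \<comment> \<open>The exceptional null set may depend on \<open>a\<close>, so the random value
    \<open>E 1 \<omega>\<close> cannot be inserted for \<open>a\<close>. \<open>Suc n\<close> keeps
    every time positive.\<close>
  have "AE \<omega> in M. \<forall>n. hausdorff_dim ((\<lambda>x. Y x \<omega>) ` {0..inverse (real (Suc n))}) = c1 \<and>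
                       packing_dim ((\<lambda>x. Y x \<omega>) ` {0..inverse (real (Suc n))}) = c2"
    unfolding AE_all_countable by (intro allI assms(9)) simp
  moreover have "AE \<omega> in M. \<forall>n. hausdorff_dim ((\<lambda>x. Y x \<omega>) ` {0..real (Suc n)}) = c1 \<and>
                                packing_dim ((\<lambda>x. Y x \<omega>) ` {0..real (Suc n)}) = c2"
    unfolding AE_all_countable by (intro allI assms(9)) simp
  ultimately show ?thesis
    using assms(8) AE_space
  proof eventually_elim
    case (elim \<omega>)
    let ?Y = "\<lambda>x. Y x \<omega>"
    have "(\<lambda>t. E t \<omega>) ` {0..1} = {0..E 1 \<omega>}"
      using image_Icc_mono_on_continuous[of 0 1 "\<lambda>t. E t \<omega>"]
        mono_on_subset[OF assms(5)[OF elim(4)], of "{0..1}"]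
        continuous_on_subset[OF assms(6)[OF elim(4)], of "{0..1}"] assms(4)[OF elim(4)]
      by auto
    moreover have "(\<lambda>t. X t \<omega>) ` {0..1} = ?Y ` (\<lambda>t. E t \<omega>) ` {0..1}"
      unfolding image_image using assms(7) elim(4) by (intro image_cong) auto
    ultimately have X: "(\<lambda>t. X t \<omega>) ` {0..1} = ?Y ` {0..E 1 \<omega>}"
      by simp
    \<comment> \<open>Both \<open>m\<close> and \<open>n\<close> depend on \<open>\<omega>\<close>,
      which is allowed because the events above hold for all indices at once.\<close>
    obtain m where m: "inverse (real (Suc m)) < E 1 \<omega>"
      using reals_Archimedean[OF elim(3)] by blast
    obtain n where n: "E 1 \<omega> \<le> real (Suc n)"
      by (meson real_arch_simple le_SucI of_nat_le_iff order.trans lessI less_imp_le)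
    have "?Y ` {0..inverse (real (Suc m))} \<subseteq> ?Y ` {0..E 1 \<omega>}"
      using m by (intro image_mono) auto
    moreover have "?Y ` {0..E 1 \<omega>} \<subseteq> ?Y ` {0..real (Suc n)}"
      using n by (intro image_mono) auto
    ultimately show ?case
      unfolding X
      \<comment> \<open>The inner and outer sets share the dimensions \<open>c1\<close> and
        \<open>c2\<close>, so the set between them has these too.\<close>
      using elim(1,2) hausdorff_dim_mono packing_dim_mono by (metis order.antisym)
  qed
qed

end
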